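(* Let $\tau: W\subset\mathbb{R}^n\to\mathbb{R}^n$ be a smooth mapping, decomposed into components $\tau(y)=(f_1(y),\dots,f_n(y))$. (i) If $\tau$ is analytic, then each $f_i$ admits a unique expansion in the structured multivariate basis: $$f_i(y)=\sum_{k=0}^{\infty}\frac{1}{k!}\,\mathcal{J}^{[k]}(f_i)(\mathfrak{c})\cdot\phi^{[k]}(y-\mathfrak{c}),$$ where $\mathcal{J}^{[k]}$ and $\phi^{[k]}$ denote the generalized derivative matrix and the generalized monomial vector, and $\mathfrak{c}$ is the expansion center. Consequently, the mapping $\tau$ admits a unique representation in the structured Taylor basis. (ii) If $\tau$ is merely smooth, then for any compact $K\subset W$ and $\epsilon>0$, there exists an analytic mapping $\tilde\tau$ whose truncated expansion in the structured Taylor basis approximates $\tau$ to within $\epsilon$: $$\|\tau-\tilde\tau\|_{C^0(K)}<\epsilon.$$ Thus, the structured Taylor model (truncated expansions in the structured Taylor basis) can approximate any smooth registration mapping $\tau$ arbitrarily closely on compact subsets of $W$.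
   Context: A registration mapping is a map $\tau:W\subset\mathbb{R}^n\to\mathbb{R}^n$ carrying moving points to fixed points; smooth means $C^\infty$. The point $\mathfrak{c}\in W$ is the expansion center. For $k\in\{0,1,2,\dots\}$ let $N_k=\binom{n+k-1}{n-1}$, the number of multi-indices $(m_1,\dots,m_n)$ of nonnegative integers with $m_1+\cdots+m_n=k$; fix an ordering of these multi-indices. Generalized derivative matrix: for a smooth vector-valued function $f=(f_1,\dots,f_n)$ of $y\in\mathbb{R}^n$, $\mathcal{J}^{[k]}(f)(\mathfrak{c})\in\mathbb{R}^{n\times N_k}$ is the matrix whose $i$-th row, in the column of the multi-index $(m_1,\dots,m_n)$, has entry $\frac{\partial^k f_i}{\partial y_1^{m_1}\cdots\partial y_n^{m_n}}(\mathfrak{c})$. For a single scalar component $f_i$, $\mathcal{J}^{[k]}(f_i)(\mathfrak{c})\in\mathbb{R}^{1\times N_k}$ is the corresponding row. Generalized monomial vector: $\phi^{[k]}(y-\mathfrak{c})\in\mathbb{R}^{N_k}$ is the column vector whose entry at the multi-index $(m_1,\dots,m_n)$ (same ordering) is $\frac{k!}{m_1!\cdots m_n!}(y_1-\mathfrak{c}_1)^{m_1}\cdots(y_n-\mathfrak{c}_n)^{m_n}$; in particular $\phi^{[0]}=1$. The dot denotes the matrix–vector product. The representation of $\tau$ in the structured Taylor basis is $\tau(y)=\sum_{k=0}^\infty\frac{1}{k!}\mathcal{J}^{[k]}(\tau)(\mathfrak{c})\cdot\phi^{[k]}(y-\mathfrak{c})$. The truncated (order-$m$) expansion of a map $g$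 in this basis is $\sum_{k=0}^m\frac{1}{k!}\mathcal{J}^{[k]}(g)(\mathfrak{c})\cdot\phi^{[k]}(y-\mathfrak{c})$. $\|\cdot\|$ is the Euclidean norm and $\|g\|_{C^0(K)}=\sup_{y\in K}\|g(y)\|$.
   Formalization: In (i) the expansion is asserted, and is unique, on some ball around the center c inside the open set W, not on all of W: 1/(1+x²) is analytic on the whole line but its Taylor series at 0 diverges for |x| ≥ 1. *)

theory Defs
  imports "HOL-Analysis.Analysis" "HOL-Library.Multiset"
begin

text \<open>
  Points of \<open>\<real>\<^sup>n\<close> are elements of \<^typ>\<open>real ^ 'n\<close>, and a multi-index is a function
  \<open>'n \<Rightarrow> nat\<close>. Maps defined on a subset \<open>W\<close> of \<open>\<real>\<^sup>n\<close> are total functions in HOL; since \<open>W\<close> is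
  required to be open, none of the notions below depends on values outside \<open>W\<close>.
\<close>

subsection \<open>Partial derivatives, smoothness, analyticity\<close>

definition partial :: "'n::finite \<Rightarrow> (real ^ 'n \<Rightarrow> real) \<Rightarrow> real ^ 'n \<Rightarrow> real" where
  "partial i f y = deriv (\<lambda>t. f (y + t *\<^sub>R axis i 1)) 0"

definition has_partial :: "'n::finite \<Rightarrow> (real ^ 'n \<Rightarrow> real) \<Rightarrow> real ^ 'n \<Rightarrow> bool" where
  "has_partial i f y \<longleftrightarrow> (\<lambda>t. f (y + t *\<^sub>R axis i 1)) field_differentiable (at 0)"

definition iter_partial :: "'n::finite list \<Rightarrow> (real ^ 'n \<Rightarrow> real) \<Rightarrow> real ^ 'n \<Rightarrow> real" where
  "iter_partial is f = foldr partial is f"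

text \<open>\<open>C\<^sup>\<infinity>\<close>: all iterated partial derivatives, in any order, exist and are continuous on \<open>W\<close>.\<close>

definition smooth_fun :: "(real ^ 'n::finite) set \<Rightarrow> (real ^ 'n \<Rightarrow> real) \<Rightarrow> bool" where
  "smooth_fun W f \<longleftrightarrow> open W \<and>
     (\<forall>is. continuous_on W (iter_partial is f) \<and>
           (\<forall>i. \<forall>y\<in>W. has_partial i (iter_partial is f) y))"

definition smooth_map :: "(real ^ 'n::finite) set \<Rightarrow> (real ^ 'n \<Rightarrow> real ^ 'n) \<Rightarrow> bool" where
  "smooth_map W g \<longleftrightarrow> (\<forall>i. smooth_fun W (\<lambda>y. g y $ i))"

definition monomial :: "('n::finite \<Rightarrow> nat) \<Rightarrow> real ^ 'n \<Rightarrow> real" where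
  "monomial \<alpha> z = (\<Prod>i\<in>UNIV. (z $ i) ^ \<alpha> i)"

text \<open>Around every point of \<open>W\<close> the function is the sum of an (unconditionally, hence absolutely,
  convergent) power series indexed by the multi-indices.\<close>

definition analytic_fun :: "(real ^ 'n::finite) set \<Rightarrow> (real ^ 'n \<Rightarrow> real) \<Rightarrow> bool" where
  "analytic_fun W f \<longleftrightarrow> open W \<and>
     (\<forall>p\<in>W. \<exists>r>0. \<exists>a :: ('n \<Rightarrow> nat) \<Rightarrow> real. ball p r \<subseteq> W \<and>
        (\<forall>y\<in>ball p r. ((\<lambda>\<alpha>. a \<alpha> * monomial \<alpha> (y - p)) has_sum f y) UNIV))"

definition analytic_map :: "(real ^ 'n::finite) set \<Rightarrow> (real ^ 'n \<Rightarrow> real ^ 'n) \<Rightarrow> bool" where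
  "analytic_map W g \<longleftrightarrow> (\<forall>i. analytic_fun W (\<lambda>y. g y $ i))"

text \<open>The index type carries no order, so a listing of the coordinates \<open>1, \<dots>, n\<close> is chosen. It only
  fixes the order in which the factors of a mixed partial derivative are applied, which is
  immaterial for smooth functions.\<close>

definition coords :: "'n::finite list" where
  "coords = (SOME is. distinct is \<and> set is = UNIV)"

definition mixed_partial :: "('n::finite \<Rightarrow> nat) \<Rightarrow> (real ^ 'n \<Rightarrow> real) \<Rightarrow> real ^ 'n \<Rightarrow> real" where
  "mixed_partial \<alpha> f = foldr (\<lambda>i. partial i ^^ \<alpha> i) coords f"

subsection \<open>Orderings of the multi-indices\<close>

definition multi_indices :: "nat \<Rightarrow> ('n::finite \<Rightarrow> nat) set" where
  "multi_indices k = {\<alpha>. (\<Sum>i\<in>UNIV. \<alpha> i) = k}"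

text \<open>\<open>N\<^sub>k\<close> in dimension \<open>n\<close>\<close>

definition num_multi :: "nat \<Rightarrow> nat \<Rightarrow> nat" where
  "num_multi n k = (n + k - 1) choose (n - 1)"

definition multi_ordering :: "(nat \<Rightarrow> nat \<Rightarrow> 'n::finite \<Rightarrow> nat) \<Rightarrow> bool" where
  "multi_ordering \<mu> \<longleftrightarrow>
     (\<forall>k. bij_betw (\<mu> k) {..<num_multi CARD('n) k} (multi_indices k))"

lemma card_multi_indices:
  "finite (multi_indices k :: ('n::finite \<Rightarrow> nat) set)"
  "card (multi_indices k :: ('n \<Rightarrow> nat) set) = num_multi CARD('n) k"
proof -
  have sz: "size M = (\<Sum>i\<in>UNIV. count M i)" for M :: "'n multiset"
    unfolding size_multiset_overloaded_eq
    by (rule sum.mono_neutral_left) (auto simp: not_in_iff)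
  have b: "bij_betw count (multisets_of_size (UNIV :: 'n set) k) (multi_indices k)"
    unfolding bij_betw_def
  proof
    show "inj_on count (multisets_of_size (UNIV :: 'n set) k)"
      by (auto simp: inj_on_def count_inject)
    show "count ` multisets_of_size (UNIV :: 'n set) k = multi_indices k"
    proof (intro equalityI subsetI)
      fix \<alpha> :: "'n \<Rightarrow> nat" assume a: "\<alpha> \<in> multi_indices k"
      have c: "count (Abs_multiset \<alpha>) = \<alpha>"
        by (rule Abs_multiset_inverse) simp
      with a have "Abs_multiset \<alpha> \<in> multisets_of_size UNIV k"
        by (simp add: multisets_of_size_def multi_indices_def sz)
      then show "\<alpha> \<in> count ` multisets_of_size (UNIV :: 'n set) k"
        using c by (metis imageI)
    qed (auto simp: multisets_of_size_def multi_indices_def sz)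
  qed
  have *: "card (multi_indices k :: ('n \<Rightarrow> nat) set) = (CARD('n) + k - 1) choose k"
    using bij_betw_same_card[OF b] card_multisets_of_size[of "UNIV :: 'n set" k] by simp
  have "CARD('n) + k - 1 - k = CARD('n) - 1" by simp
  then show "card (multi_indices k :: ('n \<Rightarrow> nat) set) = num_multi CARD('n) k"
    unfolding * num_multi_def
    by (metis One_nat_def Suc_leI add.commute add_diff_assoc binomial_symmetric le_add1 zero_less_card_finite)
  show "finite (multi_indices k :: ('n \<Rightarrow> nat) set)"
  proof (rule finite_subset)
    show "(multi_indices k :: ('n \<Rightarrow> nat) set) \<subseteq> PiE UNIV (\<lambda>_. {..k})"
      by (auto simp: multi_indices_def intro: member_le_sum)
  qed (simp add: finite_PiE)
qed

lemma ex_multi_ordering: "\<exists>\<mu> :: nat \<Rightarrow> nat \<Rightarrow> 'n::finite \<Rightarrow> nat. multi_ordering \<mu>"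
proof -
  have "\<exists>e. bij_betw e {..<num_multi CARD('n) k} (multi_indices k :: ('n \<Rightarrow> nat) set)" for k
    using ex_bij_betw_nat_finite[OF card_multi_indices(1)[where 'n = 'n]]
    by (metis card_multi_indices(2) lessThan_atLeast0)
  then show ?thesis unfolding multi_ordering_def by metis
qed

subsection \<open>The structured Taylor basis\<close>

text \<open>A \<open>1 \<times> N\<close> row or a vector of length \<open>N\<close> is a function on \<open>nat\<close> and an \<open>n \<times> N\<close> matrix is a
  function \<open>'n \<Rightarrow> nat \<Rightarrow> real\<close>; only column indices below \<open>N\<close> are meaningful. (The number of columns
  depends on \<open>k\<close>, so it cannot be a type.)\<close>

definition row_vec :: "nat \<Rightarrow> (nat \<Rightarrow> real) \<Rightarrow> (nat \<Rightarrow> real) \<Rightarrow> real" where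
  "row_vec N a v = (\<Sum>j<N. a j * v j)"

definition mat_vec :: "nat \<Rightarrow> ('n::finite \<Rightarrow> nat \<Rightarrow> real) \<Rightarrow> (nat \<Rightarrow> real) \<Rightarrow> real ^ 'n" where
  "mat_vec N A v = (\<chi> i. \<Sum>j<N. A i j * v j)"

definition J_row ::
  "(nat \<Rightarrow> nat \<Rightarrow> 'n::finite \<Rightarrow> nat) \<Rightarrow> nat \<Rightarrow> (real ^ 'n \<Rightarrow> real) \<Rightarrow> real ^ 'n \<Rightarrow> nat \<Rightarrow> real" where
  "J_row \<mu> k f c = (\<lambda>j. mixed_partial (\<mu> k j) f c)"

definition J_mat ::
  "(nat \<Rightarrow> nat \<Rightarrow> 'n::finite \<Rightarrow> nat) \<Rightarrow> nat \<Rightarrow> (real ^ 'n \<Rightarrow> real ^ 'n) \<Rightarrow> real ^ 'n \<Rightarrow> 'n \<Rightarrow> nat \<Rightarrow> real" where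
  "J_mat \<mu> k g c = (\<lambda>i. J_row \<mu> k (\<lambda>y. g y $ i) c)"

definition phi :: "(nat \<Rightarrow> nat \<Rightarrow> 'n::finite \<Rightarrow> nat) \<Rightarrow> nat \<Rightarrow> real ^ 'n \<Rightarrow> nat \<Rightarrow> real" where
  "phi \<mu> k z = (\<lambda>j. fact k / (\<Prod>i\<in>UNIV. fact (\<mu> k j i)) * monomial (\<mu> k j) z)"

text \<open>The function is the sum of the series with coefficients \<open>A\<close>, degree by degree, on some
  neighbourhood of the expansion center inside \<open>W\<close>. Convergence on all of \<open>W\<close> cannot be asked
  for: \<open>1 / (1 + x\<^sup>2)\<close> is analytic on the whole line.\<close>

definition has_row_expansion ::
  "(nat \<Rightarrow> nat \<Rightarrow> 'n::finite \<Rightarrow> nat) \<Rightarrow> (real ^ 'n) set \<Rightarrow> real ^ 'n \<Rightarrow>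
   (nat \<Rightarrow> nat \<Rightarrow> real) \<Rightarrow> (real ^ 'n \<Rightarrow> real) \<Rightarrow> bool" where
  "has_row_expansion \<mu> W c A f \<longleftrightarrow>
     (\<exists>r>0. ball c r \<subseteq> W \<and>
        (\<forall>y\<in>ball c r.
           (\<lambda>k. 1 / fact k * row_vec (num_multi CARD('n) k) (A k) (phi \<mu> k (y - c))) sums f y))"

definition has_mat_expansion ::
  "(nat \<Rightarrow> nat \<Rightarrow> 'n::finite \<Rightarrow> nat) \<Rightarrow> (real ^ 'n) set \<Rightarrow> real ^ 'n \<Rightarrow>
   (nat \<Rightarrow> 'n \<Rightarrow> nat \<Rightarrow> real) \<Rightarrow> (real ^ 'n \<Rightarrow> real ^ 'n) \<Rightarrow> bool" where
  "has_mat_expansion \<mu> W c A g \<longleftrightarrow>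
     (\<exists>r>0. ball c r \<subseteq> W \<and>
        (\<forall>y\<in>ball c r.
           (\<lambda>k. (1 / fact k) *\<^sub>R mat_vec (num_multi CARD('n) k) (A k) (phi \<mu> k (y - c))) sums g y))"

definition taylor_model ::
  "(nat \<Rightarrow> nat \<Rightarrow> 'n::finite \<Rightarrow> nat) \<Rightarrow> real ^ 'n \<Rightarrow> nat \<Rightarrow>
   (nat \<Rightarrow> 'n \<Rightarrow> nat \<Rightarrow> real) \<Rightarrow> real ^ 'n \<Rightarrow> real ^ 'n" where
  "taylor_model \<mu> c m A y =
     (\<Sum>k\<le>m. (1 / fact k) *\<^sub>R mat_vec (num_multi CARD('n) k) (A k) (phi \<mu> k (y - c)))"

definition truncated_expansion ::
  "(nat \<Rightarrow> nat \<Rightarrow> 'n::finite \<Rightarrow> nat) \<Rightarrow> real ^ 'n \<Rightarrow> nat \<Rightarrow>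
   (real ^ 'n \<Rightarrow> real ^ 'n) \<Rightarrow> real ^ 'n \<Rightarrow> real ^ 'n" where
  "truncated_expansion \<mu> c m g = taylor_model \<mu> c m (\<lambda>k. J_mat \<mu> k g c)"

text \<open>The supremum norm over the empty set is \<open>0\<close>; \<open>Sup {}\<close> is unspecified on the reals. It is only
  used for functions continuous on a compact set, where the supremum is finite.\<close>

definition C0_norm :: "(real ^ 'n::finite) set \<Rightarrow> (real ^ 'n \<Rightarrow> real ^ 'n) \<Rightarrow> real" where
  "C0_norm K g = (if K = {} then 0 else (SUP y\<in>K. norm (g y)))"

end

theory Submission
  imports Defs
begin

text \<open>
  A multi-index power series on a ball may be differentiated term by term on the same ball, so the
  mixed partial derivative of order \<open>\<alpha>\<close> at the centre is \<open>\<alpha>!\<close> times the coefficient at \<open>\<alpha>\<close>; grouping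
  the series by degree gives the expansion in the structured basis. For uniqueness, a vanishing series
  of homogeneous polynomials restricts along each ray through the centre to a vanishing power
  series in one variable, so every homogeneous part vanishes near the centre, and hence so do its
  coefficients. For approximation, Stone--Weierstrass provides a polynomial map, which is analytic
  and equals its own truncated expansion of high enough order.
\<close>

subsection \<open>Termwise differentiation of multi-index power series\<close>

text \<open>This is the inner condition of \<open>analytic_fun\<close> with centre, radius and
  coefficients exposed, so that differentiation can be tracked on one fixed ball.\<close>

definition power_series_on ::
  "real ^ 'n::finite \<Rightarrow> real \<Rightarrow> (('n \<Rightarrow> nat) \<Rightarrow> real) \<Rightarrow> (real ^ 'n \<Rightarrow> real) \<Rightarrow> bool" where
  "power_series_on p r a f \<longleftrightarrow>
     (\<forall>y\<in>ball p r. ((\<lambda>\<alpha>. a \<alpha> * monomial \<alpha> (y - p)) has_sum f y) UNIV)"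

text \<open>Formal differentiation: only the monomial with one more factor of coordinate
  \<open>i\<close> than \<beta> has a derivative that is a multiple of the monomial at \<beta>, and
  it brings down the exponent \<beta> i + 1.\<close>

definition coeff_partial :: "'n::finite \<Rightarrow> (('n \<Rightarrow> nat) \<Rightarrow> real) \<Rightarrow> ('n \<Rightarrow> nat) \<Rightarrow> real" where
  "coeff_partial i a = (\<lambda>\<beta>. real (Suc (\<beta> i)) * a (\<beta>(i := Suc (\<beta> i))))"

text \<open>By convexity, the tangent to the k-th power at \<open>x\<close>, evaluated at \<rho>,
  stays below \<rho>^k. This trades the factor \<open>k\<close> produced by differentiation for a
  slightly larger radius. The summand \<open>x ^ k\<close> carries the induction.\<close>

lemma power_diff_bound:
  fixes x \<rho> :: real
  assumes "0 \<le> x" "x \<le> \<rho>"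
  shows "real k * x ^ (k - 1) * (\<rho> - x) + x ^ k \<le> \<rho> ^ k"
proof (induction k)
  case 0
  then show ?case by simp
next
  case (Suc k)
  have "x * (real k * x ^ (k - 1)) = real k * x ^ k"
    by (cases k) auto
  then have "x * (real k * x ^ (k - 1) * (\<rho> - x)) = real k * x ^ k * (\<rho> - x)"
    by (metis mult.assoc)
  then have "real (Suc k) * x ^ (Suc k - 1) * (\<rho> - x) + x ^ Suc k
      = x * (real k * x ^ (k - 1) * (\<rho> - x)) + \<rho> * x ^ k"
    by (simp add: algebra_simps)
  also have "\<dots> \<le> \<rho> * (real k * x ^ (k - 1) * (\<rho> - x)) + \<rho> * x ^ k"
    using assms by (intro add_right_mono mult_right_mono mult_nonneg_nonneg) auto
  also have "\<dots> \<le> \<rho> * \<rho> ^ k"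
    using mult_left_mono[OF Suc, of \<rho>] assms by (simp add: algebra_simps)
  finally show ?case by simp
qed

lemma monomial_split:
  "monomial \<alpha> z = (z $ i) ^ \<alpha> i * (\<Prod>j\<in>UNIV - {i}. (z $ j) ^ \<alpha> j)"
  unfolding monomial_def by (rule prod.remove) auto

lemma monomial_add_axis:
  "monomial \<alpha> (z + t *\<^sub>R axis i 1) = (z $ i + t) ^ \<alpha> i * (\<Prod>j\<in>UNIV - {i}. (z $ j) ^ \<alpha> j)"
proof -
  have "(\<Prod>j\<in>UNIV - {i}. ((z + t *\<^sub>R axis i 1) $ j) ^ \<alpha> j) = (\<Prod>j\<in>UNIV - {i}. (z $ j) ^ \<alpha> j)"
    by (intro prod.cong) (auto simp: axis_def)
  then show ?thesis
    by (simp add: monomial_split[of \<alpha> _ i] axis_def)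
qed

text \<open>On the line through \<open>y\<close> in direction \<open>i\<close> every term is a
  polynomial in \<open>t\<close>, and the Weierstrass M-test near t = 0 justifies termwise
  differentiation. The radius is not reduced, so the result can be iterated.\<close>

lemma power_series_on_partial:
  assumes ps: "power_series_on p r a f"
  shows "power_series_on p r (coeff_partial i a) (partial i f)"
  unfolding power_series_on_def
proof
  fix y assume y: "y \<in> ball p r"
  define z where "z = y - p"
  \<comment> \<open>The gap between \<open>norm z\<close> and \<open>r\<close> is cut into three:
    \<open>t\<close> varies up to \<delta>, the majorizing point lies at distance 2 \<delta>, and
    every shift below 3 \<delta> stays in the ball. The sign \<open>s\<close> pushes the coordinate
    away from 0, so that its modulus grows by exactly the shift.\<close>
  define \<delta> where "\<delta> = (r - norm z) / 3"
  define \<sigma> where "\<sigma> = \<bar>z $ i\<bar> + \<delta>"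
  define \<rho> where "\<rho> = \<bar>z $ i\<bar> + 2 * \<delta>"
  define s :: real where "s = (if z $ i \<ge> 0 then 1 else - 1)"
  define Q where "Q \<alpha> = (\<Prod>j\<in>UNIV - {i}. (z $ j) ^ \<alpha> j)" for \<alpha>
  define h where "h \<alpha> t = a \<alpha> * monomial \<alpha> (z + t *\<^sub>R axis i 1)" for \<alpha> t
  define h' where "h' \<alpha> t = a \<alpha> * (real (\<alpha> i) * (z $ i + t) ^ (\<alpha> i - 1) * Q \<alpha>)" for \<alpha> t
  define M where "M \<alpha> = \<bar>h \<alpha> (s * (2 * \<delta>))\<bar> / (\<rho> - \<sigma>)" for \<alpha>
  have nz: "norm z < r"
    using y by (simp add: z_def dist_norm norm_minus_commute)
  then have \<delta>: "\<delta> > 0" by (simp add: \<delta>_def)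
  have hs: "((\<lambda>\<alpha>. h \<alpha> t) has_sum f (y + t *\<^sub>R axis i 1)) UNIV" if "\<bar>t\<bar> < 3 * \<delta>" for t
  proof -
    have "norm (z + t *\<^sub>R axis i 1) \<le> norm z + \<bar>t\<bar>"
      by (rule norm_triangle_le) simp
    also have "\<dots> < r" using that by (simp add: \<delta>_def)
    finally have "y + t *\<^sub>R axis i 1 \<in> ball p r"
      by (simp add: z_def dist_norm norm_minus_commute algebra_simps)
    then have "((\<lambda>\<alpha>. a \<alpha> * monomial \<alpha> (y + t *\<^sub>R axis i 1 - p)) has_sum f (y + t *\<^sub>R axis i 1)) UNIV"
      using ps unfolding power_series_on_def by blast
    moreover have "y + t *\<^sub>R axis i 1 - p = z + t *\<^sub>R axis i 1" by (simp add: z_def)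
    ultimately show ?thesis unfolding h_def by (simp only:)
  qed
  have "\<bar>s * (2 * \<delta>)\<bar> < 3 * \<delta>" using \<delta> by (auto simp: s_def)
  from hs[OF this] have "(\<lambda>\<alpha>. \<bar>h \<alpha> (s * (2 * \<delta>))\<bar>) summable_on UNIV"
    using summable_on_iff_abs_summable_on_real[of "\<lambda>\<alpha>. h \<alpha> (s * (2 * \<delta>))" UNIV]
    by (auto simp: summable_on_def)
  then have sM: "M summable_on UNIV"
    unfolding M_def divide_inverse by (rule summable_on_cmult_left)
  \<comment> \<open>The \<open>i\<close>-th coordinate of the point \<open>z + s * 2\<delta> * e\<^sub>i\<close>, which still lies in the ball, has modulus \<open>\<rho>\<close>,
    so the series at that point majorizes the differentiated series wherever \<open>\<bar>t\<bar> < \<delta>\<close>.\<close>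
  have bound: "norm (h' \<alpha> t) \<le> M \<alpha>" if "\<bar>t\<bar> < \<delta>" for \<alpha> t
  proof -
    have x: "\<bar>z $ i + t\<bar> \<le> \<sigma>" using that by (auto simp: \<sigma>_def)
    have "real (\<alpha> i) * \<sigma> ^ (\<alpha> i - 1) * (\<rho> - \<sigma>) + \<sigma> ^ \<alpha> i \<le> \<rho> ^ \<alpha> i"
      by (rule power_diff_bound) (use \<delta> in \<open>auto simp: \<sigma>_def \<rho>_def\<close>)
    moreover have "\<sigma> ^ \<alpha> i \<ge> 0" using \<delta> by (simp add: \<sigma>_def)
    ultimately have "real (\<alpha> i) * \<sigma> ^ (\<alpha> i - 1) * (\<rho> - \<sigma>) \<le> \<rho> ^ \<alpha> i" by linarith
    then have b: "real (\<alpha> i) * \<sigma> ^ (\<alpha> i - 1) \<le> \<rho> ^ \<alpha> i / (\<rho> - \<sigma>)"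
      using \<delta> by (simp add: \<sigma>_def \<rho>_def field_simps)
    have eq: "\<bar>z $ i + s * (2 * \<delta>)\<bar> = \<rho>" using \<delta> by (auto simp: \<rho>_def s_def)
    have "norm (h' \<alpha> t) = \<bar>a \<alpha>\<bar> * \<bar>Q \<alpha>\<bar> * (real (\<alpha> i) * \<bar>z $ i + t\<bar> ^ (\<alpha> i - 1))"
      by (simp add: h'_def abs_mult power_abs)
    also have "\<dots> \<le> \<bar>a \<alpha>\<bar> * \<bar>Q \<alpha>\<bar> * (real (\<alpha> i) * \<sigma> ^ (\<alpha> i - 1))"
      by (intro mult_left_mono power_mono x) auto
    also have "\<dots> \<le> \<bar>a \<alpha>\<bar> * \<bar>Q \<alpha>\<bar> * (\<rho> ^ \<alpha> i / (\<rho> - \<sigma>))"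
      by (intro mult_left_mono b) auto
    also have "\<dots> = M \<alpha>"
      by (simp add: M_def h_def monomial_add_axis abs_mult power_abs eq Q_def)
    finally show ?thesis .
  qed
  \<comment> \<open>Termwise differentiation is applied to series over the naturals, so the
    multi-indices are enumerated bijectively. Their set is infinite because evaluation at
    \<open>i\<close> maps it onto all naturals.\<close>
  have "infinite (UNIV :: ('a \<Rightarrow> nat) set)"
  proof
    assume "finite (UNIV :: ('a \<Rightarrow> nat) set)"
    then have "finite ((\<lambda>\<alpha>. \<alpha> i) ` (UNIV :: ('a \<Rightarrow> nat) set))" by (rule finite_imageI)
    moreover have "k \<in> (\<lambda>\<alpha>. \<alpha> i) ` (UNIV :: ('a \<Rightarrow> nat) set)" for k
      by (rule image_eqI[of _ _ "\<lambda>_. k"]) auto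
    then have "(\<lambda>\<alpha>. \<alpha> i) ` (UNIV :: ('a \<Rightarrow> nat) set) = UNIV" by blast
    ultimately show False by simp
  qed
  then obtain e :: "nat \<Rightarrow> 'a \<Rightarrow> nat" where e: "bij e"
    using bij_betw_from_nat_into[of "UNIV :: ('a \<Rightarrow> nat) set"] by auto
  have sums_h: "(\<lambda>n. h (e n) t) sums f (y + t *\<^sub>R axis i 1)" if "\<bar>t\<bar> < \<delta>" for t
    using hs[of t] that \<delta> has_sum_reindex_bij_betw[OF e, of "\<lambda>\<alpha>. h \<alpha> t"]
    by (intro has_sum_imp_sums) auto
  have sMe: "summable (\<lambda>n. M (e n))"
    using sM summable_on_reindex_bij_betw[OF e, of M] by (intro summable_on_imp_summable) simp
  have "((\<lambda>t. \<Sum>n. h (e n) t) has_field_derivative (\<Sum>n. h' (e n) 0)) (at 0)"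
  proof (rule has_field_derivative_series'(2)[where S = "ball 0 \<delta>" and x0 = 0])
    fix n and t :: real assume "t \<in> ball 0 \<delta>"
    show "(h (e n) has_field_derivative h' (e n) t) (at t within ball 0 \<delta>)"
      unfolding h_def[abs_def] h'_def monomial_add_axis Q_def
      by (auto intro!: derivative_eq_intros)
  next
    show "uniformly_convergent_on (ball 0 \<delta>) (\<lambda>n t. \<Sum>k<n. h' (e k) t)"
      by (rule Weierstrass_m_test'[OF _ sMe]) (use bound in auto)
  next
    show "summable (\<lambda>n. h (e n) 0)"
      using sums_h[of 0] \<delta> by (simp add: sums_iff)
  qed (use \<delta> in auto)
  then have "((\<lambda>t. f (y + t *\<^sub>R axis i 1)) has_field_derivative (\<Sum>n. h' (e n) 0)) (at 0)"
    by (rule has_field_derivative_transform_within_open[where S = "ball 0 \<delta>"])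
      (use \<delta> sums_unique[OF sums_h, symmetric] in auto)
  then have der: "partial i f y = (\<Sum>n. h' (e n) 0)"
    unfolding partial_def by (rule DERIV_imp_deriv)
  \<comment> \<open>The way back from the enumerated series to the unordered sum: absolute
    summability gives existence, and the enumeration identifies the value.\<close>
  have "(\<lambda>\<alpha>. norm (h' \<alpha> 0)) summable_on UNIV"
    by (rule Infinite_Sum.abs_summable_on_comparison_test'[OF sM]) (use bound \<delta> in auto)
  then have hsum: "((\<lambda>\<alpha>. h' \<alpha> 0) has_sum infsum (\<lambda>\<alpha>. h' \<alpha> 0) UNIV) UNIV"
    by (rule has_sum_infsum[OF abs_summable_summable])
  then have "(\<lambda>n. h' (e n) 0) sums infsum (\<lambda>\<alpha>. h' \<alpha> 0) UNIV"
    by (intro has_sum_imp_sums has_sum_reindex_bij_betw[OF e, THEN iffD2])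
  then have "infsum (\<lambda>\<alpha>. h' \<alpha> 0) UNIV = partial i f y"
    unfolding der by (rule sums_unique)
  with hsum have "((\<lambda>\<alpha>. h' \<alpha> 0) has_sum partial i f y) UNIV"
    by (simp only:)
  \<comment> \<open>Terms with \<alpha> i = 0 carry the factor 0. Dropping them makes the shift of
    the \<open>i\<close>-th exponent by one a bijection, with no truncated subtraction at 0.\<close>
  also have "?this \<longleftrightarrow> ((\<lambda>\<alpha>. h' \<alpha> 0) has_sum partial i f y) {\<alpha>. \<alpha> i > 0}"
    by (rule has_sum_cong_neutral) (auto simp: h'_def)
  also have "\<dots> \<longleftrightarrow>
      ((\<lambda>\<beta>. coeff_partial i a \<beta> * monomial \<beta> (y - p)) has_sum partial i f y) UNIV"
  proof (rule has_sum_reindex_bij_witness[where j = "\<lambda>\<alpha>. \<alpha>(i := \<alpha> i - 1)" and i = "\<lambda>\<beta>. \<beta>(i := Suc (\<beta> i))"])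
    fix \<alpha> :: "'a \<Rightarrow> nat" assume "\<alpha> \<in> {\<alpha>. \<alpha> i > 0}"
    moreover have "(\<Prod>j\<in>UNIV - {i}. (z $ j) ^ (\<alpha>(i := \<alpha> i - 1)) j) = Q \<alpha>"
      unfolding Q_def by (intro prod.cong) auto
    ultimately show "coeff_partial i a (\<alpha>(i := \<alpha> i - 1)) * monomial (\<alpha>(i := \<alpha> i - 1)) (y - p) = h' \<alpha> 0"
      by (simp add: coeff_partial_def h'_def monomial_split[of _ _ i] flip: z_def)
  qed auto
  finally show "((\<lambda>\<beta>. coeff_partial i a \<beta> * monomial \<beta> (y - p)) has_sum partial i f y) UNIV" .
qed

section \<open>Coefficients as derivatives at the centre\<close>

lemma coeff_partial_funpow:
  "(coeff_partial i ^^ k) a \<beta> = fact (\<beta> i + k) / fact (\<beta> i) * a (\<beta>(i := \<beta> i + k))"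
proof (induction k arbitrary: \<beta>)
  case (Suc k)
  let ?\<beta> = "\<beta>(i := Suc (\<beta> i))"
  have "(coeff_partial i ^^ Suc k) a \<beta> = real (Suc (\<beta> i)) * (coeff_partial i ^^ k) a ?\<beta>"
    by (simp add: coeff_partial_def)
  also have "\<dots> = real (Suc (\<beta> i)) * (fact (Suc (\<beta> i) + k) / fact (Suc (\<beta> i)) * a (\<beta>(i := Suc (\<beta> i) + k)))"
    by (simp only: Suc.IH fun_upd_same fun_upd_upd)
  also have "\<dots> = real (Suc (\<beta> i)) / fact (Suc (\<beta> i)) * (fact (Suc (\<beta> i) + k) * a (\<beta>(i := Suc (\<beta> i) + k)))"
    by (simp only: times_divide_eq_left times_divide_eq_right mult.assoc)
  also have "real (Suc (\<beta> i)) / fact (Suc (\<beta> i)) = 1 / fact (\<beta> i)"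
    by (simp add: fact_Suc del: of_nat_Suc)
  finally show ?case by simp
qed simp

text \<open>Distinctness keeps the derivatives in different coordinates from interacting, so the
  factors multiply. At \<beta> = 0, with all coordinates listed, the product is the multi-index
  factorial of \<alpha>.\<close>

lemma coeff_partial_foldr:
  assumes "distinct is"
  shows "foldr (\<lambda>i. coeff_partial i ^^ \<alpha> i) is a \<beta> =
    (\<Prod>i\<in>set is. fact (\<beta> i + \<alpha> i) / fact (\<beta> i)) *
      a (\<lambda>j. if j \<in> set is then \<beta> j + \<alpha> j else \<beta> j)"
  using assms
proof (induction "is" arbitrary: \<beta>)
  case (Cons i "is")
  let ?\<beta> = "\<beta>(i := \<beta> i + \<alpha> i)"
  have distinct: "distinct is" using Cons.prems by simp
  have 1: "(\<Prod>j\<in>set is. fact (?\<beta> j + \<alpha> j) / fact (?\<beta> j) :: real) = (\<Prod>j\<in>set is. fact (\<beta> j + \<alpha> j) / fact (\<beta> j))"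
    using Cons.prems by (intro prod.cong) auto
  have 2: "(\<lambda>j. if j \<in> set is then ?\<beta> j + \<alpha> j else ?\<beta> j) =
      (\<lambda>j. if j \<in> set (i # is) then \<beta> j + \<alpha> j else \<beta> j)"
    using Cons.prems by auto
  have "foldr (\<lambda>i. coeff_partial i ^^ \<alpha> i) (i # is) a \<beta> =
      (coeff_partial i ^^ \<alpha> i) (foldr (\<lambda>i. coeff_partial i ^^ \<alpha> i) is a) \<beta>" by simp
  also have "\<dots> = fact (\<beta> i + \<alpha> i) / fact (\<beta> i) * foldr (\<lambda>i. coeff_partial i ^^ \<alpha> i) is a ?\<beta>"
    by (rule coeff_partial_funpow)
  also have "foldr (\<lambda>i. coeff_partial i ^^ \<alpha> i) is a ?\<beta> =
      (\<Prod>j\<in>set is. fact (\<beta> j + \<alpha> j) / fact (\<beta> j)) *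
        a (\<lambda>j. if j \<in> set (i # is) then \<beta> j + \<alpha> j else \<beta> j)"
    unfolding Cons.IH[OF distinct] 1 2 ..
  finally show ?case using Cons.prems by simp
qed simp

lemma coords: "distinct (coords :: 'n::finite list)" "set (coords :: 'n list) = UNIV"
proof -
  have "\<exists>is :: 'n list. distinct is \<and> set is = UNIV"
    using finite_distinct_list[of "UNIV :: 'n set"] by auto
  from someI_ex[OF this] show "distinct (coords :: 'n list)" "set (coords :: 'n list) = UNIV"
    unfolding coords_def by auto
qed

lemma power_series_on_mixed_partial:
  assumes "power_series_on p r a f"
  shows "power_series_on p r (foldr (\<lambda>i. coeff_partial i ^^ \<alpha> i) coords a) (mixed_partial \<alpha> f)"
proof -
  have pow: "power_series_on p r ((coeff_partial i ^^ k) b) ((partial i ^^ k) g)"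
    if "power_series_on p r b g" for i k b g
    using that by (induction k) (simp_all add: power_series_on_partial)
  have "power_series_on p r (foldr (\<lambda>i. coeff_partial i ^^ \<alpha> i) is a)
      (foldr (\<lambda>i. partial i ^^ \<alpha> i) is f)" for "is"
    using assms by (induction "is") (simp_all add: pow)
  then show ?thesis unfolding mixed_partial_def .
qed

text \<open>At the centre every monomial vanishes except the constant one, where 0^0 = 1.\<close>

lemma power_series_on_center:
  assumes "power_series_on p r a f" "r > 0"
  shows "f p = a (\<lambda>_. 0)"
proof -
  have "monomial \<alpha> (p - p) = (if \<alpha> = (\<lambda>_. 0) then 1 else 0)" for \<alpha> :: "'a \<Rightarrow> nat"
    by (auto simp: monomial_def fun_eq_iff)
  then have "(\<lambda>\<alpha>. if \<alpha> = (\<lambda>_. 0) then a \<alpha> else 0) = (\<lambda>\<alpha>. a \<alpha> * monomial \<alpha> (p - p))"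
    by auto
  moreover have "((\<lambda>\<alpha>. a \<alpha> * monomial \<alpha> (p - p)) has_sum f p) UNIV"
    using assms unfolding power_series_on_def by (meson centre_in_ball)
  ultimately have "((\<lambda>\<alpha>. if \<alpha> = (\<lambda>_. 0) then a \<alpha> else 0) has_sum f p) UNIV"
    by (simp only:)
  moreover have "((\<lambda>\<alpha>. if \<alpha> = (\<lambda>_. 0) then a \<alpha> else 0) has_sum a (\<lambda>_. 0)) UNIV"
    by (rule has_sum_finite_neutralI[where B = "{\<lambda>_. 0}"]) auto
  ultimately show ?thesis by (rule has_sum_unique)
qed

lemma mixed_partial_center:
  assumes "power_series_on p r a f" "r > 0"
  shows "mixed_partial \<alpha> f p = (\<Prod>i\<in>UNIV. fact (\<alpha> i)) * a \<alpha>"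
  using power_series_on_center[OF power_series_on_mixed_partial[OF assms(1)] assms(2)]
  by (simp add: coeff_partial_foldr coords)

lemma power_series_on_unique:
  fixes a b :: "('n::finite \<Rightarrow> nat) \<Rightarrow> real"
  assumes "power_series_on p r a f" "power_series_on p r b f" "r > 0"
  shows "a = b"
proof
  fix \<alpha> :: "'n \<Rightarrow> nat"
  have "(\<Prod>i\<in>UNIV. fact (\<alpha> i)) \<noteq> (0 :: real)" by simp
  then show "a \<alpha> = b \<alpha>"
    using mixed_partial_center[OF assms(1,3), of \<alpha>] mixed_partial_center[OF assms(2,3), of \<alpha>] by simp
qed

text \<open>Every multi-index has exactly one degree, so the sum can be taken over pairs of a degree
  and a multi-index of that degree. Unordered summation then allows summing each finite degree block
  first.\<close>

lemma power_series_on_homogeneous_sums: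
  assumes "power_series_on p r a f" "y \<in> ball p r"
  shows "(\<lambda>k. \<Sum>\<alpha>\<in>multi_indices k. a \<alpha> * monomial \<alpha> (y - p)) sums f y"
proof -
  let ?t = "\<lambda>\<alpha>. a \<alpha> * monomial \<alpha> (y - p)"
  have "bij_betw snd (Sigma UNIV (multi_indices :: nat \<Rightarrow> ('a \<Rightarrow> nat) set)) UNIV"
    by (auto simp: bij_betw_def inj_on_def multi_indices_def image_iff)
  from has_sum_reindex_bij_betw[OF this, of ?t "f y"]
  have "((\<lambda>x. ?t (snd x)) has_sum f y) (Sigma UNIV multi_indices)"
    using assms unfolding power_series_on_def by blast
  then have "((\<lambda>k. sum ?t (multi_indices k)) has_sum f y) UNIV"
    by (rule has_sum_SigmaD) (simp add: card_multi_indices(1))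
  then show ?thesis by (rule has_sum_imp_sums)
qed

subsection \<open>Expansions in the structured basis\<close>

text \<open>The scalar 1/k! and the multinomial factor in \<open>phi\<close> cancel against the
  multi-index factorial. Since \<mu> k is a bijection, the ordering disappears from the
  result.\<close>

lemma row_vec_phi:
  fixes \<mu> :: "nat \<Rightarrow> nat \<Rightarrow> 'n::finite \<Rightarrow> nat"
  assumes "multi_ordering \<mu>"
  shows "1 / fact k * row_vec (num_multi CARD('n) k) (\<lambda>j. (\<Prod>i\<in>UNIV. fact (\<mu> k j i)) * a (\<mu> k j)) (phi \<mu> k z)
    = (\<Sum>\<alpha>\<in>multi_indices k. a \<alpha> * monomial \<alpha> z)"
proof -
  have "1 / fact k * row_vec (num_multi CARD('n) k) (\<lambda>j. (\<Prod>i\<in>UNIV. fact (\<mu> k j i)) * a (\<mu> k j)) (phi \<mu> k z)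
    = (\<Sum>j<num_multi CARD('n) k. a (\<mu> k j) * monomial (\<mu> k j) z)"
    unfolding row_vec_def phi_def sum_distrib_left by (intro sum.cong) auto
  also have "\<dots> = (\<Sum>\<alpha>\<in>multi_indices k. a \<alpha> * monomial \<alpha> z)"
    using assms unfolding multi_ordering_def
    by (intro sum.reindex_bij_betw[where g = "\<lambda>\<alpha>. a \<alpha> * monomial \<alpha> z"]) auto
  finally show ?thesis .
qed

lemma power_series_on_J_row:
  assumes "multi_ordering \<mu>" "power_series_on c r a f" "r > 0"
  shows "1 / fact k * row_vec (num_multi CARD('n) k) (J_row \<mu> k f c) (phi \<mu> k (z :: real ^ 'n::finite))
    = (\<Sum>\<alpha>\<in>multi_indices k. a \<alpha> * monomial \<alpha> z)"
  unfolding J_row_def mixed_partial_center[OF assms(2,3)] by (rule row_vec_phi[OF assms(1)])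

lemma analytic_fun_has_row_expansion:
  assumes "multi_ordering \<mu>" "analytic_fun W f" "c \<in> W"
  shows "has_row_expansion \<mu> W c (\<lambda>k. J_row \<mu> k f c) f"
proof -
  obtain r a where r: "r > 0" "ball c r \<subseteq> W" "power_series_on c r a f"
    using assms(2,3) unfolding analytic_fun_def power_series_on_def by blast
  show ?thesis
    unfolding has_row_expansion_def power_series_on_J_row[OF assms(1) r(3,1)]
    using power_series_on_homogeneous_sums[OF r(3)] r(1,2) by blast
qed

section \<open>Uniqueness of expansions summed degree by degree\<close>

lemma powser_sums_zero_coeff:
  fixes b :: "nat \<Rightarrow> real"
  assumes "\<And>t. \<bar>t\<bar> < 1 \<Longrightarrow> (\<lambda>k. b k * t ^ k) sums 0"
  shows "b k = 0"
proof (induction k rule: less_induct)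
  case (less k)
  \<comment> \<open>Once the lower coefficients vanish, dividing by \<open>t ^ k\<close> leaves a
    series with constant term \<open>b k\<close> and sum 0 for t \<noteq> 0. Its limit at 0 is
    therefore both 0 and \<open>b k\<close>.\<close>
  have "((\<lambda>_. 0) \<longlongrightarrow> b (0 + k)) (at (0 :: real))"
  proof (rule powser_limit_0_strong[where s = 1])
    fix t :: real assume t: "t \<noteq> 0" "norm t < 1"
    then have "(\<lambda>n. b (n + k) * t ^ (n + k)) sums (0 - (\<Sum>n<k. b n * t ^ n))"
      using sums_split_initial_segment[OF assms[of t], of k] by simp
    then have "(\<lambda>n. b (n + k) * t ^ (n + k) / t ^ k) sums (0 / t ^ k)"
      using less by (intro sums_divide) simp
    then show "(\<lambda>n. b (n + k) * t ^ n) sums 0"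
      using t by (simp add: power_add)
  qed simp
  then show ?case
    by (simp add: tendsto_const_iff)
qed

lemma phi_scaleR:
  assumes "multi_ordering \<mu>" "j < num_multi CARD('n) k"
  shows "phi \<mu> k (t *\<^sub>R (z :: real ^ 'n::finite)) j = t ^ k * phi \<mu> k z j"
proof -
  have "\<mu> k j \<in> multi_indices k"
    using assms unfolding multi_ordering_def by (meson bij_betwE lessThan_iff)
  then show ?thesis
    by (simp add: phi_def monomial_def multi_indices_def power_mult_distrib prod.distrib flip: power_sum)
qed

text \<open>The expansions converge only degree by degree, so \<open>power_series_on_unique\<close>
  does not apply to them directly. The degrees are first separated along rays; a single homogeneous
  part is a finite sum, to which it does apply.\<close>

lemma has_row_expansion_unique:
  fixes \<mu> :: "nat \<Rightarrow> nat \<Rightarrow> 'n::finite \<Rightarrow> nat"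
  assumes \<mu>: "multi_ordering \<mu>"
    and A: "has_row_expansion \<mu> W c A f" and B: "has_row_expansion \<mu> W c B f"
    and j: "j < num_multi CARD('n) k"
  shows "A k j = B k j"
proof -
  let ?N = "\<lambda>k. num_multi CARD('n) k"
  obtain r1 where r1: "r1 > 0"
    "\<And>y. y \<in> ball c r1 \<Longrightarrow> (\<lambda>k. 1 / fact k * row_vec (?N k) (A k) (phi \<mu> k (y - c))) sums f y"
    using A unfolding has_row_expansion_def by blast
  obtain r2 where r2: "r2 > 0"
    "\<And>y. y \<in> ball c r2 \<Longrightarrow> (\<lambda>k. 1 / fact k * row_vec (?N k) (B k) (phi \<mu> k (y - c))) sums f y"
    using B unfolding has_row_expansion_def by blast
  define r where "r = min r1 r2"
  define P where "P k z = 1 / fact k * row_vec (?N k) (\<lambda>j. A k j - B k j) (phi \<mu> k z)" for k z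
  have P_scale: "P k (t *\<^sub>R z) = P k z * t ^ k" for k t z
    unfolding P_def row_vec_def sum_distrib_left sum_distrib_right
    by (intro sum.cong) (auto simp: phi_scaleR[OF \<mu>])
  have P_sums: "(\<lambda>k. P k z) sums 0" if "norm z < r" for z
  proof -
    have "c + z \<in> ball c r1" "c + z \<in> ball c r2" using that by (auto simp: r_def dist_norm)
    from sums_diff[OF r1(2)[OF this(1)] r2(2)[OF this(2)]] show ?thesis
      by (simp add: P_def row_vec_def left_diff_distrib sum_subtractf diff_divide_distrib)
  qed
  \<comment> \<open>Along the ray through \<open>z\<close> the difference of the two expansions is a
    power series in \<open>t\<close> with coefficients \<open>P k z\<close>.\<close>
  have P0: "P k z = 0" if "norm z < r" for z
  proof (rule powser_sums_zero_coeff[where b = "\<lambda>k. P k z"])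
    fix t :: real assume "\<bar>t\<bar> < 1"
    then have "norm (t *\<^sub>R z) < r"
      using that by (smt (verit) mult_left_le_one_le norm_ge_zero norm_scaleR)
    from P_sums[OF this] show "(\<lambda>k. P k z * t ^ k) sums 0" by (simp add: P_scale)
  qed
  \<comment> \<open>Inverting the ordering turns column indices into multi-indices; the division in
    \<open>d\<close> compensates for the factorials in \<open>row_vec_phi\<close>.\<close>
  define g where "g = inv_into {..<?N k} (\<mu> k)"
  define d where "d \<alpha> = (A k (g \<alpha>) - B k (g \<alpha>)) / (\<Prod>i\<in>UNIV. fact (\<alpha> i))" for \<alpha> :: "'n \<Rightarrow> nat"
  have bij: "bij_betw (\<mu> k) {..<?N k} (multi_indices k)"
    using \<mu> unfolding multi_ordering_def by blast
  then have g: "g (\<mu> k j) = j" if "j < ?N k" for j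
    unfolding g_def using that by (intro inv_into_f_f) (auto simp: bij_betw_def)
  have "(\<Sum>\<alpha>\<in>multi_indices k. d \<alpha> * monomial \<alpha> z) = P k z" for z
    unfolding row_vec_phi[OF \<mu>, symmetric] P_def row_vec_def
    by (intro arg_cong2[where f = "(*)"] sum.cong) (auto simp: d_def g)
  then have z: "(\<Sum>\<alpha>\<in>multi_indices k. d \<alpha> * monomial \<alpha> z) = 0" if "norm z < r" for z
    using P0[OF that] by simp
  have "power_series_on 0 r (\<lambda>\<alpha>. if \<alpha> \<in> multi_indices k then d \<alpha> else 0) (\<lambda>_. 0)"
    unfolding power_series_on_def
    by (intro ballI has_sum_finite_neutralI[where B = "multi_indices k"])
      (auto simp: card_multi_indices(1) z)
  moreover have "power_series_on 0 r (\<lambda>_. 0) (\<lambda>_ :: real ^ 'n. 0)"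
    by (simp add: power_series_on_def)
  moreover have "r > 0" using r1(1) r2(1) by (simp add: r_def)
  ultimately have "(\<lambda>\<alpha>. if \<alpha> \<in> multi_indices k then d \<alpha> else 0) = (\<lambda>_. 0)"
    by (rule power_series_on_unique)
  moreover have "\<mu> k j \<in> multi_indices k" using bij j by (auto simp: bij_betw_def)
  ultimately have "d (\<mu> k j) = 0" by (metis (mono_tags))
  then show ?thesis using j by (simp add: d_def g)
qed

section \<open>Passage between components and vector-valued maps\<close>

lemma mat_vec_nth: "mat_vec N A v $ i = row_vec N (A i) v"
  by (simp add: mat_vec_def row_vec_def)

lemma sums_vec_iff: "f sums s \<longleftrightarrow> (\<forall>i. (\<lambda>k. f k $ i) sums (s $ i))"
  for f :: "nat \<Rightarrow> real ^ 'n::finite"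
proof
  assume "f sums s"
  then show "\<forall>i. (\<lambda>k. f k $ i) sums (s $ i)"
    by (auto intro: bounded_linear.sums[OF bounded_linear_vec_nth])
next
  assume "\<forall>i. (\<lambda>k. f k $ i) sums (s $ i)"
  then show "f sums s"
    unfolding sums_def by (intro vec_tendstoI) simp
qed

text \<open>Each component comes with its own radius; as there are finitely many, the least of them
  is positive and serves all components.\<close>

lemma has_mat_expansion_iff:
  fixes g :: "real ^ 'n::finite \<Rightarrow> real ^ 'n"
  shows "has_mat_expansion \<mu> W c A g \<longleftrightarrow> (\<forall>i. has_row_expansion \<mu> W c (\<lambda>k. A k i) (\<lambda>y. g y $ i))"
proof
  assume "has_mat_expansion \<mu> W c A g"
  then show "\<forall>i. has_row_expansion \<mu> W c (\<lambda>k. A k i) (\<lambda>y. g y $ i)"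
    unfolding has_mat_expansion_def has_row_expansion_def sums_vec_iff
      vector_scaleR_component mat_vec_nth real_scaleR_def by blast
next
  assume "\<forall>i. has_row_expansion \<mu> W c (\<lambda>k. A k i) (\<lambda>y. g y $ i)"
  then have "\<exists>r. \<forall>i. r i > 0 \<and> ball c (r i) \<subseteq> W \<and> (\<forall>y\<in>ball c (r i).
      (\<lambda>k. 1 / fact k * row_vec (num_multi CARD('n) k) (A k i) (phi \<mu> k (y - c))) sums (g y $ i))"
    unfolding has_row_expansion_def by (rule choice)
  then obtain r where r: "r i > 0" "ball c (r i) \<subseteq> W"
    "\<forall>y\<in>ball c (r i). (\<lambda>k. 1 / fact k *
       row_vec (num_multi CARD('n) k) (A k i) (phi \<mu> k (y - c))) sums (g y $ i)" for i
    by blast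
  define R where "R = Min (range r)"
  have R: "R > 0" "\<And>i. R \<le> r i" using r(1) by (auto simp: R_def)
  have "ball c R \<subseteq> W" by (rule subset_trans[OF subset_ball[OF R(2)] r(2)])
  moreover have "(\<lambda>k. (1 / fact k) *\<^sub>R mat_vec (num_multi CARD('n) k) (A k) (phi \<mu> k (y - c))) sums g y"
    if "y \<in> ball c R" for y
    unfolding sums_vec_iff vector_scaleR_component mat_vec_nth real_scaleR_def
    using bspec[OF r(3) subsetD[OF subset_ball[OF R(2)] that]] by blast
  ultimately show "has_mat_expansion \<mu> W c A g"
    unfolding has_mat_expansion_def using R(1) by blast
qed

subsection \<open>Polynomial maps\<close>

text \<open>The centre \<open>p\<close> is arbitrary because analyticity needs an expansion about
  every point of the domain, and the truncated expansion needs one about \<open>c\<close>.\<close>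

lemma real_polynomial_function_monomials:
  fixes f :: "real ^ 'n::finite \<Rightarrow> real"
  assumes "real_polynomial_function f"
  shows "\<exists>S a. finite S \<and> f = (\<lambda>y. \<Sum>\<alpha>\<in>S. a \<alpha> * monomial \<alpha> (y - p))"
  using assms
proof (induction rule: real_polynomial_function.induct)
  case (const b)
  show ?case
    by (rule exI[of _ "{\<lambda>_. 0}"], rule exI[of _ "\<lambda>_. b"]) (simp add: monomial_def)
next
  case (add f g)
  from add.IH(1) obtain S a where S: "finite S" "f = (\<lambda>y. \<Sum>\<alpha>\<in>S. a \<alpha> * monomial \<alpha> (y - p))"
    by blast
  from add.IH(2) obtain T b where T: "finite T" "g = (\<lambda>y. \<Sum>\<alpha>\<in>T. b \<alpha> * monomial \<alpha> (y - p))"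
    by blast
  have "f y + g y = (\<Sum>\<alpha>\<in>S \<union> T. ((if \<alpha> \<in> S then a \<alpha> else 0) + (if \<alpha> \<in> T then b \<alpha> else 0)) * monomial \<alpha> (y - p))" for y
    unfolding S(2) T(2) distrib_right sum.distrib
    by (rule arg_cong2[where f = "(+)"]; rule sum.mono_neutral_cong_left) (use S(1) T(1) in auto)
  then have "(\<lambda>y. f y + g y) = (\<lambda>y. \<Sum>\<alpha>\<in>S \<union> T.
      ((if \<alpha> \<in> S then a \<alpha> else 0) + (if \<alpha> \<in> T then b \<alpha> else 0)) * monomial \<alpha> (y - p))"
    by (rule ext)
  moreover have "finite (S \<union> T)" using S(1) T(1) by simp
  ultimately show ?case by (intro exI[of _ "S \<union> T"] exI[of _ "\<lambda>\<alpha>. (if \<alpha> \<in> S then a \<alpha> else 0) + (if \<alpha> \<in> T then b \<alpha> else 0)"] conjI)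
next
  case (mult f g)
  from mult.IH(1) obtain S a where S: "finite S" "f = (\<lambda>y. \<Sum>\<alpha>\<in>S. a \<alpha> * monomial \<alpha> (y - p))"
    by blast
  from mult.IH(2) obtain T b where T: "finite T" "g = (\<lambda>y. \<Sum>\<alpha>\<in>T. b \<alpha> * monomial \<alpha> (y - p))"
    by blast
  \<comment> \<open>Several pairs of exponents may have the same sum, so the coefficient of the
    product collects all pairs in a fibre of \<open>add\<close>.\<close>
  define add :: "('n \<Rightarrow> nat) \<times> ('n \<Rightarrow> nat) \<Rightarrow> 'n \<Rightarrow> nat"
    where "add = (\<lambda>(\<alpha>, \<beta>) i. \<alpha> i + \<beta> i)"
  let ?ab = "\<lambda>x. a (fst x) * b (snd x)"
  let ?d = "\<lambda>\<gamma>. \<Sum>x | x \<in> S \<times> T \<and> add x = \<gamma>. ?ab x"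
  have "f y * g y = (\<Sum>\<gamma>\<in>add ` (S \<times> T). ?d \<gamma> * monomial \<gamma> (y - p))" for y
  proof -
    have m: "monomial (add x) z = monomial (fst x) z * monomial (snd x) z" for x and z :: "real ^ 'n"
      by (cases x) (simp add: add_def monomial_def power_add prod.distrib)
    have "f y * g y = (\<Sum>x\<in>S \<times> T. ?ab x * monomial (add x) (y - p))"
      unfolding S(2) T(2) sum_product sum.cartesian_product m
      by (intro sum.cong) auto
    also have "\<dots> = (\<Sum>\<gamma>\<in>add ` (S \<times> T). \<Sum>x | x \<in> S \<times> T \<and> add x = \<gamma>. ?ab x * monomial (add x) (y - p))"
      using S(1) T(1) by (intro sum.image_gen) auto
    also have "\<dots> = (\<Sum>\<gamma>\<in>add ` (S \<times> T). ?d \<gamma> * monomial \<gamma> (y - p))"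
      unfolding sum_distrib_right by (intro sum.cong) auto
    finally show ?thesis .
  qed
  then have "(\<lambda>y. f y * g y) = (\<lambda>y. \<Sum>\<gamma>\<in>add ` (S \<times> T). ?d \<gamma> * monomial \<gamma> (y - p))"
    by (rule ext)
  moreover have "finite (add ` (S \<times> T))" using S(1) T(1) by simp
  ultimately show ?case by (intro exI[of _ "add ` (S \<times> T)"] exI[of _ ?d] conjI)
next
  case (linear f)
  \<comment> \<open>\<open>e i\<close> is the exponent of the single coordinate \<open>i\<close>.
    The expansion comes from f y = f p + f (y - p), with the second summand written in the standard
    basis; \<open>inv e\<close> recovers the coordinate from its exponent.\<close>
  define e where "e i = (\<lambda>j. if j = i then 1 else 0 :: nat)" for i :: 'n
  have inj: "inj e"
  proof (rule injI)
    fix i j assume "e i = e j"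
    then have "e i i = e j i" by simp
    then show "i = j" by (simp add: e_def split: if_splits)
  qed
  have e_neq: "e i \<noteq> (\<lambda>_. 0)" for i
  proof
    assume "e i = (\<lambda>_. 0)"
    then have "e i i = 0" by simp
    then show False by (simp add: e_def)
  qed
  then have e0: "(\<lambda>_. 0) \<notin> range e" by (metis rangeE)
  have me: "monomial (e i) z = z $ i" for i and z :: "real ^ 'n"
  proof -
    have "monomial (e i) z = (\<Prod>j\<in>UNIV. if j = i then z $ j else 1)"
      unfolding monomial_def by (intro prod.cong) (auto simp: e_def)
    then show ?thesis by simp
  qed
  let ?a = "\<lambda>\<alpha>. if \<alpha> = (\<lambda>_. 0) then f p else f (axis (inv e \<alpha>) 1)"
  have "f y = (\<Sum>\<alpha>\<in>insert (\<lambda>_. 0) (range e). ?a \<alpha> * monomial \<alpha> (y - p))" for y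
  proof -
    have lin: "linear f" using linear by (rule bounded_linear.linear)
    have "y - p = (\<Sum>i\<in>UNIV. (y - p) $ i *\<^sub>R axis i 1)"
      using basis_expansion[of "y - p"] by (simp add: scalar_mult_eq_scaleR)
    then have "f (y - p) = f (\<Sum>i\<in>UNIV. (y - p) $ i *\<^sub>R axis i 1)" by (rule arg_cong)
    also have "\<dots> = (\<Sum>i\<in>UNIV. (y - p) $ i * f (axis i 1))"
      by (simp add: linear_sum[OF lin] linear_scale[OF lin])
    finally have "f (y - p) = (\<Sum>i\<in>UNIV. (y - p) $ i * f (axis i 1))" .
    then have "f y = f p + (\<Sum>i\<in>UNIV. f (axis i 1) * monomial (e i) (y - p))"
      unfolding me linear_diff[OF lin] by (simp add: mult.commute)
    also have "(\<Sum>i\<in>UNIV. f (axis i 1) * monomial (e i) (y - p)) =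
        (\<Sum>\<alpha>\<in>range e. ?a \<alpha> * monomial \<alpha> (y - p))"
      unfolding sum.reindex[OF inj] o_def by (simp add: inv_f_f[OF inj] e_neq)
    finally show ?thesis
      using e0 by (simp add: monomial_def)
  qed
  then have "f = (\<lambda>y. \<Sum>\<alpha>\<in>insert (\<lambda>_. 0) (range e). ?a \<alpha> * monomial \<alpha> (y - p))"
    by (rule ext)
  moreover have "finite (insert (\<lambda>_. 0) (range e))" by simp
  ultimately show ?case by (intro exI[of _ "insert (\<lambda>_. 0) (range e)"] exI[of _ ?a] conjI)
qed

lemma monomial_sum_power_series_on:
  assumes "finite S"
  shows "power_series_on p r (\<lambda>\<alpha>. if \<alpha> \<in> S then a \<alpha> else 0) (\<lambda>y. \<Sum>\<alpha>\<in>S. a \<alpha> * monomial \<alpha> (y - p))"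
  unfolding power_series_on_def
  by (intro ballI has_sum_finite_neutralI[where B = S]) (use assms in auto)

lemma real_polynomial_function_analytic:
  assumes "open W" "real_polynomial_function f"
  shows "analytic_fun W f"
  unfolding analytic_fun_def
proof (intro conjI ballI)
  fix p assume "p \<in> W"
  then obtain r where "r > 0" "ball p r \<subseteq> W" using assms(1) open_contains_ball by blast
  moreover obtain S a where S: "finite S" and f: "f = (\<lambda>y. \<Sum>\<alpha>\<in>S. a \<alpha> * monomial \<alpha> (y - p))"
    using real_polynomial_function_monomials[OF assms(2)] by blast
  have "power_series_on p r (\<lambda>\<alpha>. if \<alpha> \<in> S then a \<alpha> else 0) f"
    unfolding f by (rule monomial_sum_power_series_on[OF S])
  ultimately show "\<exists>r>0. \<exists>a. ball p r \<subseteq> W \<and>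
      (\<forall>y\<in>ball p r. ((\<lambda>\<alpha>. a \<alpha> * monomial \<alpha> (y - p)) has_sum f y) UNIV)"
    unfolding power_series_on_def
    by (intro exI[of _ r] exI[of _ "\<lambda>\<alpha>. if \<alpha> \<in> S then a \<alpha> else 0"] conjI)
qed (rule assms(1))

lemma truncated_expansion_nth:
  fixes g :: "real ^ 'n::finite \<Rightarrow> real ^ 'n"
  shows "truncated_expansion \<mu> c m g y $ i =
    (\<Sum>k\<le>m. 1 / fact k * row_vec (num_multi CARD('n) k) (J_row \<mu> k (\<lambda>y. g y $ i) c) (phi \<mu> k (y - c)))"
  unfolding truncated_expansion_def taylor_model_def by (simp add: mat_vec_nth J_mat_def)

text \<open>All coefficients above the largest degree occurring in any component vanish, so
  truncation there loses nothing, and the identity holds at every point.\<close>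

lemma polynomial_truncated_expansion:
  fixes g :: "real ^ 'n::finite \<Rightarrow> real ^ 'n"
  assumes \<mu>: "multi_ordering \<mu>" and g: "\<And>i. real_polynomial_function (\<lambda>y. g y $ i)"
  shows "\<exists>m. truncated_expansion \<mu> c m g = g"
proof -
  have "\<exists>S. \<forall>i. \<exists>a. finite (S i) \<and> (\<lambda>y. g y $ i) = (\<lambda>y. \<Sum>\<alpha>\<in>S i. a \<alpha> * monomial \<alpha> (y - c))"
    by (intro choice allI real_polynomial_function_monomials[OF g])
  then obtain S where "\<forall>i. \<exists>a. finite (S i) \<and> (\<lambda>y. g y $ i) = (\<lambda>y. \<Sum>\<alpha>\<in>S i. a \<alpha> * monomial \<alpha> (y - c))" ..
  from choice[OF this] obtain a where S: "finite (S i)"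
    and eq: "(\<lambda>y. g y $ i) = (\<lambda>y. \<Sum>\<alpha>\<in>S i. a i \<alpha> * monomial \<alpha> (y - c))" for i by blast
  \<comment> \<open>Inserting 0 keeps the maximum defined when every \<open>S i\<close> is
    empty.\<close>
  define m where "m = Max (insert 0 ((\<lambda>\<alpha>. sum \<alpha> UNIV) ` (\<Union>i. S i)))"
  have m: "sum \<alpha> UNIV \<le> m" if "\<alpha> \<in> S i" for \<alpha> i
    unfolding m_def using that S by (intro Max_ge) auto
  have "truncated_expansion \<mu> c m g y $ i = g y $ i" for y i
  proof -
    let ?b = "\<lambda>\<alpha>. if \<alpha> \<in> S i then a i \<alpha> else 0"
    have "power_series_on c 1 ?b (\<lambda>y. g y $ i)"
      unfolding eq by (rule monomial_sum_power_series_on[OF S])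
    then have "truncated_expansion \<mu> c m g y $ i =
        (\<Sum>k\<le>m. \<Sum>\<alpha>\<in>multi_indices k. ?b \<alpha> * monomial \<alpha> (y - c))"
      unfolding truncated_expansion_nth by (simp only: power_series_on_J_row[OF \<mu> _ zero_less_one])
    also have "\<dots> = (\<Sum>\<alpha>\<in>(\<Union>k\<in>{..m}. multi_indices k). ?b \<alpha> * monomial \<alpha> (y - c))"
      by (intro sum.UNION_disjoint[symmetric] ballI card_multi_indices(1) impI finite_atMost)
        (auto simp: multi_indices_def)
    also have "\<dots> = (\<Sum>\<alpha>\<in>S i. a i \<alpha> * monomial \<alpha> (y - c))"
      using m by (intro sum.mono_neutral_cong_right finite_UN_I card_multi_indices(1) finite_atMost)
        (auto simp: multi_indices_def)
    also have "\<dots> = g y $ i" using fun_cong[OF eq[of i], of y] by simp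
    finally show ?thesis .
  qed
  then have "truncated_expansion \<mu> c m g = g" by (simp add: fun_eq_iff vec_eq_iff)
  then show ?thesis ..
qed

section \<open>Uniform approximation on compact sets\<close>

text \<open>A strict pointwise bound by \<epsilon> alone gives only a supremum of at most
  \<epsilon>, hence the intermediate \<delta>. Positivity of \<epsilon> settles empty
  \<open>K\<close>.\<close>

lemma C0_norm_less:
  assumes "\<And>y. y \<in> K \<Longrightarrow> norm (g y) \<le> \<delta>" "\<delta> < \<epsilon>" "0 < \<epsilon>"
  shows "C0_norm K g < \<epsilon>"
proof (cases "K = {}")
  case False
  then have "(SUP y\<in>K. norm (g y)) \<le> \<delta>" using assms(1) by (intro cSUP_least) auto
  with False assms(2) show ?thesis by (simp add: C0_norm_def)
qed (simp add: C0_norm_def assms(3))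

lemma smooth_map_continuous_on:
  assumes "smooth_map W g"
  shows "continuous_on W g"
proof -
  have "continuous_on W (\<lambda>y. g y $ i)" for i
  proof -
    have "continuous_on W (iter_partial [] (\<lambda>y. g y $ i))"
      using assms unfolding smooth_map_def smooth_fun_def by blast
    then show ?thesis by (simp add: iter_partial_def)
  qed
  then have "continuous_on W (\<lambda>y. \<chi> i. g y $ i)" by (intro continuous_on_vec_lambda)
  then show ?thesis by simp
qed

lemma polynomial_approximation:
  fixes g :: "real ^ 'n::finite \<Rightarrow> real ^ 'n"
  assumes "compact K" "continuous_on K g" "0 < \<epsilon>"
  obtains q where "\<And>i. real_polynomial_function (\<lambda>y. q y $ i)" "C0_norm K (\<lambda>y. g y - q y) < \<epsilon>"
proof -
  obtain q where q: "polynomial_function q" "\<And>y. y \<in> K \<Longrightarrow> norm (g y - q y) < \<epsilon> / 2"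
    using Stone_Weierstrass_polynomial_function[OF assms(1,2), of "\<epsilon> / 2"] assms(3) by auto
  have "real_polynomial_function (\<lambda>y. q y $ i)" for i
    using q(1) bounded_linear_vec_nth[of i] unfolding polynomial_function_def o_def by blast
  moreover have "C0_norm K (\<lambda>y. g y - q y) < \<epsilon>"
    by (rule C0_norm_less[where \<delta> = "\<epsilon> / 2"]) (use q(2) assms(3) in \<open>auto intro: less_imp_le\<close>)
  ultimately show thesis by (rule that)
qed

theorem theorem4p6:
  fixes \<tau> :: "real ^ 'n::finite \<Rightarrow> real ^ 'n"
    and W :: "(real ^ 'n) set"
    and c :: "real ^ 'n"
    and \<mu> :: "nat \<Rightarrow> nat \<Rightarrow> 'n \<Rightarrow> nat"
  assumes "open W" and "c \<in> W"
    and "multi_ordering \<mu>"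
    and "smooth_map W \<tau>"
  shows
    "(analytic_map W \<tau> \<longrightarrow>
        (\<forall>i. has_row_expansion \<mu> W c (\<lambda>k. J_row \<mu> k (\<lambda>y. \<tau> y $ i) c) (\<lambda>y. \<tau> y $ i) \<and>
             (\<forall>A. has_row_expansion \<mu> W c A (\<lambda>y. \<tau> y $ i) \<longrightarrow>
                (\<forall>k. \<forall>j<num_multi CARD('n) k. A k j = J_row \<mu> k (\<lambda>y. \<tau> y $ i) c j))) \<and>
        has_mat_expansion \<mu> W c (\<lambda>k. J_mat \<mu> k \<tau> c) \<tau> \<and>
        (\<forall>A. has_mat_expansion \<mu> W c A \<tau> \<longrightarrow>
           (\<forall>k i. \<forall>j<num_multi CARD('n) k. A k i j = J_mat \<mu> k \<tau> c i j))) \<and>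
     (\<forall>K \<epsilon>. compact K \<and> K \<subseteq> W \<and> \<epsilon> > 0 \<longrightarrow>
        (\<exists>\<tau>' m. analytic_map W \<tau>' \<and>
           C0_norm K (\<lambda>y. \<tau> y - \<tau>' y) < \<epsilon> \<and>
           C0_norm K (\<lambda>y. \<tau> y - truncated_expansion \<mu> c m \<tau>' y) < \<epsilon>)) \<and>
     (\<forall>K \<epsilon>. compact K \<and> K \<subseteq> W \<and> \<epsilon> > 0 \<longrightarrow>
        (\<exists>m A. C0_norm K (\<lambda>y. \<tau> y - taylor_model \<mu> c m A y) < \<epsilon>))"
proof (intro conjI impI allI)
  fix i
  assume an: "analytic_map W \<tau>"
  then show row: "has_row_expansion \<mu> W c (\<lambda>k. J_row \<mu> k (\<lambda>y. \<tau> y $ i) c) (\<lambda>y. \<tau> y $ i)" for i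
    using analytic_fun_has_row_expansion assms(2,3) unfolding analytic_map_def by blast
  show "A k j = J_row \<mu> k (\<lambda>y. \<tau> y $ i) c j"
    if "has_row_expansion \<mu> W c A (\<lambda>y. \<tau> y $ i)" "j < num_multi CARD('n) k" for A k j
    by (rule has_row_expansion_unique[OF assms(3) that(1) row that(2)])
next
  assume an: "analytic_map W \<tau>"
  then have row: "has_row_expansion \<mu> W c (\<lambda>k. J_row \<mu> k (\<lambda>y. \<tau> y $ i) c) (\<lambda>y. \<tau> y $ i)" for i
    using analytic_fun_has_row_expansion assms(2,3) unfolding analytic_map_def by blast
  then show "has_mat_expansion \<mu> W c (\<lambda>k. J_mat \<mu> k \<tau> c) \<tau>"
    by (simp add: has_mat_expansion_iff J_mat_def)
  show "A k i j = J_mat \<mu> k \<tau> c i j"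
    if "has_mat_expansion \<mu> W c A \<tau>" "j < num_multi CARD('n) k" for A k i j
    using has_row_expansion_unique[OF assms(3) _ row that(2)] that(1)
    unfolding has_mat_expansion_iff J_mat_def by blast
next
  fix K and \<epsilon> :: real
  assume K: "compact K \<and> K \<subseteq> W \<and> \<epsilon> > 0"
  then have "continuous_on K \<tau>"
    using smooth_map_continuous_on[OF assms(4)] continuous_on_subset by blast
  with K obtain q where q: "\<And>i. real_polynomial_function (\<lambda>y. q y $ i)"
    "C0_norm K (\<lambda>y. \<tau> y - q y) < \<epsilon>"
    using polynomial_approximation by metis
  \<comment> \<open>Since \<open>q\<close> equals its truncation of order \<open>m\<close>, one
    estimate for \<open>q\<close> serves for the analytic map, its truncated expansion and the
    Taylor model.\<close>
  obtain m where m: "truncated_expansion \<mu> c m q = q"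
    using polynomial_truncated_expansion[OF assms(3) q(1)] by blast
  have "analytic_map W q"
    using real_polynomial_function_analytic[OF assms(1) q(1)] by (simp add: analytic_map_def)
  then show "\<exists>\<tau>' m. analytic_map W \<tau>' \<and> C0_norm K (\<lambda>y. \<tau> y - \<tau>' y) < \<epsilon> \<and>
      C0_norm K (\<lambda>y. \<tau> y - truncated_expansion \<mu> c m \<tau>' y) < \<epsilon>"
    using q(2) by (intro exI[of _ q] exI[of _ m]) (simp add: m)
  show "\<exists>m A. C0_norm K (\<lambda>y. \<tau> y - taylor_model \<mu> c m A y) < \<epsilon>"
    using q(2) m unfolding truncated_expansion_def
    by (intro exI[of _ m] exI[of _ "\<lambda>k. J_mat \<mu> k q c"]) simp
qed

end
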